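(* Let $V$ be a Banach space over $\mathbb{K}$ and let $W$ be a closed proper subspace of $V$ such that $W$ has a regular basic sequence and $V\setminus W$ is $\aleph_{0}$-lineable. Then, for every cardinal number $\alpha\le\mathfrak{c}$, the set $V\setminus W$ is $(\alpha,\mathfrak{c})$-spaceable in $V$ if, and only if, $\alpha<\aleph_{0}$.
   Context: $\mathbb{K}$ denotes $\mathbb{R}$ or $\mathbb{C}$; $\mathbb{N}$ is the set of positive integers; $\mathfrak{c}=\operatorname{card}(\mathbb{R})$; dimension means algebraic (Hamel) dimension. A sequence $(e_n)_{n=1}^\infty$ in a Banach space is a basic sequence if it is a Schauder basis of $\overline{\operatorname{span}\{e_n:n\in\mathbb{N}\}}$; a basic sequence is regular if it is bounded away from zero, i.e. it lies entirely outside some neighborhood of zero. A subset $A$ of a vector space $V$ is $\alpha$-lineable if $A\cup\{0\}$ contains an $\alpha$-dimensional vector subspace of $V$. For cardinals $\alpha\le\beta$ and $V$ endowed with a topology, a non-void subset $A\subset V$ is $(\alpha,\beta)$-spaceable if it is $\alpha$-lineable and for each $\alpha$-dimensional subspace $W_\alpha\subset A\cup\{0\}$ there is a closed $\beta$-dimensional subspace $W_\beta$ of $V$ with $W_\alpha\subset W_\beta\subset A\cup\{0\}$. *)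

theory Defs
  imports "HOL-Analysis.Analysis"
begin

unbundle cardinal_syntax
no_notation elt_set_eq (infix \<open>=o\<close> 50)

(* A complex Banach space is a (real) Banach space with a compatible complex
   scalar multiplication. The locale is used below with 'k = complex; for
   'k = real the last assumption forces smul = scaleR. *)
locale banach_space_over = vector_space smul
  for smul :: "'k::real_normed_field \<Rightarrow> 'a::banach \<Rightarrow> 'a" +
  assumes norm_smul: "norm (smul c x) = norm c * norm x"
    and smul_of_real: "smul (of_real r) x = r *\<^sub>R x"

(* Cardinals are cardinal orders in the sense of BNF_Cardinal_Order_Relation,
   compared up to order isomorphism. *)
abbreviation continuum :: "real rel" where
  "continuum \<equiv> |UNIV :: real set|"

definition subspace_of_dim ::
  "('k::field \<Rightarrow> 'a::ab_group_add \<Rightarrow> 'a) \<Rightarrow> 'c rel \<Rightarrow> 'a set \<Rightarrow> bool" where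
  "subspace_of_dim smul \<alpha> S \<longleftrightarrow>
     module.subspace smul S \<and>
     (\<exists>B. \<not> module.dependent smul B \<and> module.span smul B = S \<and> |B| =o \<alpha>)"

definition lineable ::
  "('k::field \<Rightarrow> 'a::ab_group_add \<Rightarrow> 'a) \<Rightarrow> 'c rel \<Rightarrow> 'a set \<Rightarrow> bool" where
  "lineable smul \<alpha> A \<longleftrightarrow> (\<exists>S. subspace_of_dim smul \<alpha> S \<and> S \<subseteq> A \<union> {0})"

definition spaceable ::
  "('k::field \<Rightarrow> 'a::{ab_group_add, topological_space} \<Rightarrow> 'a) \<Rightarrow>
     'c rel \<Rightarrow> 'd rel \<Rightarrow> 'a set \<Rightarrow> bool" where
  "spaceable smul \<alpha> \<beta> A \<longleftrightarrow>
     \<alpha> \<le>o \<beta> \<and> A \<noteq> {} \<and> lineable smul \<alpha> A \<and>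
     (\<forall>S. subspace_of_dim smul \<alpha> S \<and> S \<subseteq> A \<union> {0} \<longrightarrow>
        (\<exists>T. closed T \<and> subspace_of_dim smul \<beta> T \<and> S \<subseteq> T \<and> T \<subseteq> A \<union> {0}))"

(* Sequences are indexed from 0 instead of 1. *)
definition schauder_basis ::
  "('k::field \<Rightarrow> 'a::{ab_group_add, topological_space} \<Rightarrow> 'a) \<Rightarrow>
     (nat \<Rightarrow> 'a) \<Rightarrow> 'a set \<Rightarrow> bool" where
  "schauder_basis smul e S \<longleftrightarrow>
     range e \<subseteq> S \<and>
     (\<forall>x\<in>S. \<exists>!a :: nat \<Rightarrow> 'k. (\<lambda>n. smul (a n) (e n)) sums x)"

definition basic_sequence ::
  "('k::field \<Rightarrow> 'a::{ab_group_add, topological_space} \<Rightarrow> 'a) \<Rightarrow> (nat \<Rightarrow> 'a) \<Rightarrow> bool" where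
  "basic_sequence smul e \<longleftrightarrow>
     schauder_basis smul e (closure (module.span smul (range e)))"

definition regular_basic_sequence ::
  "('k::field \<Rightarrow> 'a::{ab_group_add, topological_space} \<Rightarrow> 'a) \<Rightarrow> (nat \<Rightarrow> 'a) \<Rightarrow> bool" where
  "regular_basic_sequence smul e \<longleftrightarrow>
     basic_sequence smul e \<and> (\<exists>U. open U \<and> 0 \<in> U \<and> range e \<inter> U = {})"

end

theory Submission
  imports Defs
begin

text \<open>
  Throughout, \<open>V\<close> is a Banach space over the scalar field \<open>\<real>\<close> or \<open>\<complex>\<close>; all arguments are
  uniform in the field and use only that it is complete and, for the dimension count, that it has
  at most continuum many elements.

  If \<open>\<alpha>\<close> is infinite, take any \<open>\<alpha>\<close>-dimensional subspace with basis \<open>B\<close> that meets \<open>W\<close> only in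
  \<open>0\<close>, a nonzero \<open>w \<in> W\<close>, and distinct \<open>b\<^sub>0, b\<^sub>1, \<dots>\<close> in \<open>B\<close>. Replacing \<open>b\<^sub>n\<close> by
  \<open>w + \<epsilon>\<^sub>n b\<^sub>n\<close> only rescales the basis modulo \<open>W\<close>, so the new span still has dimension \<open>\<alpha>\<close> and
  meets \<open>W\<close> only in \<open>0\<close> (\<open>independent_modulo_subspace\<close>). If \<open>\<epsilon>\<^sub>n b\<^sub>n \<longrightarrow> 0\<close>, then \<open>w\<close> lies in
  every closed set containing that span, so no closed extension avoids \<open>W\<close>.

  If \<open>\<alpha>\<close> is finite, let \<open>S = span F\<close> be given, with \<open>F\<close> finite. Let \<open>E\<close> be the closed span of the
  basic sequence \<open>e\<close> in \<open>W\<close>, with coefficient functionals \<open>coef y n\<close>, and put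
  \<open>\<Phi> y = y + (\<Sum>n. coef y n \<cdot> u\<^sub>n)\<close> for very small vectors \<open>u\<^sub>n\<close>. The space wanted is
  \<open>T = \<Phi> ` E + S\<close>. Two facts make it work.

  \<^item> The coefficient functionals are uniformly bounded (\<open>coef_bound\<close>). So for small \<open>u\<^sub>n\<close> the map
    \<open>\<Phi>\<close> is a perturbation of the identity that is bounded below; hence \<open>\<Phi> ` E\<close> is closed, and so is
    \<open>T\<close>, a finite-dimensional extension of it. The bound rests on Baire's theorem, used as in the
    open mapping theorem. Boundedness of \<open>e\<close> away from \<open>0\<close> is what makes it uniform in \<open>n\<close>.
  \<^item> The \<open>u\<^sub>n\<close> can be chosen so that a bounded scalar sequence \<open>a\<close> with
    \<open>(\<Sum>n. a\<^sub>n u\<^sub>n) \<in> W + S\<close> must vanish (\<open>rapidly_decreasing_sequence_independent\<close>). If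
    \<open>\<Phi> y + s \<in> W\<close> with \<open>y \<in> E \<subseteq> W\<close> and \<open>s \<in> S\<close>, then \<open>\<Sum>n. coef y n \<cdot> u\<^sub>n\<close> lies in \<open>W + S\<close>, so all
    coefficients of \<open>y\<close> vanish, \<open>y = 0\<close>, and \<open>s \<in> S \<inter> W\<close> is \<open>0\<close>. Hence \<open>T\<close> meets \<open>W\<close> only in \<open>0\<close>.

  The \<open>u\<^sub>n\<close> are vectors independent modulo \<open>W + S\<close>, scaled down so fast that in
  \<open>\<Sum>n. a\<^sub>n u\<^sub>n\<close> the term of an index where \<open>\<bar>a\<^sub>n\<bar>\<close> almost attains its supremum outweighs all later
  terms even modulo the earlier ones. This replaces the biorthogonal functionals that the
  Hahn-Banach theorem would supply.

  Finally, \<open>T\<close> has at most continuum many elements, because its elements are coded by scalar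
  sequences; and the images under \<open>\<Phi>\<close> of the vectors with coefficients proportional to \<open>r\<^sup>n\<close>,
  \<open>0 < r < 1\<close>, are continuum many independent elements (\<open>geometric_family_independent\<close>).
\<close>

section \<open>Geometric sequences and cardinalities\<close>

text \<open>
  The hypothesis says that the functional \<open>p \<mapsto> \<Sum>l\<in>t. c l * p (g l)\<close> kills all monomials, hence
  all polynomials. A polynomial with roots \<open>g m\<close> for \<open>m \<noteq> l\<close> isolates \<open>c l\<close>.
\<close>

lemma Vandermonde_eq_0:
  fixes c g :: "'b \<Rightarrow> 'k::field"
  assumes "finite t" "inj_on g t" "\<And>n. (\<Sum>l\<in>t. c l * g l ^ n) = 0" "l \<in> t"
  shows "c l = 0"
proof -
  have poly: "(\<Sum>l\<in>t. c l * poly p (g l)) = 0" for p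
  proof -
    have "(\<Sum>l\<in>t. c l * poly p (g l)) = (\<Sum>i\<le>degree p. coeff p i * (\<Sum>l\<in>t. c l * g l ^ i))"
      unfolding poly_altdef sum_distrib_left by (subst sum.swap) (simp add: mult_ac)
    then show ?thesis
      by (simp add: assms(3))
  qed
  define p where "p = (\<Prod>m\<in>t - {l}. [:- g m, 1:])"
  have p: "poly p (g m) = 0" if "m \<in> t - {l}" for m
    unfolding p_def poly_prod using that assms(1) by (intro prod_zero) auto
  have "poly p (g l) \<noteq> 0"
    unfolding p_def poly_prod using assms(1,2,4) by (auto simp: inj_on_def)
  moreover have "(\<Sum>l\<in>t. c l * poly p (g l)) = c l * poly p (g l)"
    using assms(1,4) p by (subst sum.remove[of _ l]) auto
  ultimately show ?thesis
    using poly[of p] by simp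
qed

text \<open>
  A sequence of reals is a sequence of sets of naturals, that is, a set of pairs of naturals, that is,
  a set of naturals.
\<close>

lemma card_sequences_le_continuum:
  assumes "|UNIV :: 'k set| \<le>o continuum"
  shows "|UNIV :: (nat \<Rightarrow> 'k) set| \<le>o continuum"
proof -
  obtain j :: "'k \<Rightarrow> real" where j: "inj j"
    using assms card_of_ordLeq[of "UNIV :: 'k set" "UNIV :: real set"] by auto
  have "(UNIV :: real set) \<lesssim> (UNIV :: nat set set)" "(UNIV :: nat set set) \<lesssim> (UNIV :: real set)"
    using nat_sets_eqpoll_reals eqpoll_imp_lepoll eqpoll_sym by blast+
  then obtain k :: "real \<Rightarrow> nat set" and h :: "nat set \<Rightarrow> real" where kh: "inj k" "inj h"
    unfolding lepoll_def by auto
  define G :: "(nat \<Rightarrow> 'k) \<Rightarrow> nat set" where "G f = {m. snd (prod_decode m) \<in> k (j (f (fst (prod_decode m))))}" for f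
  have G: "prod_encode (n, m) \<in> G f \<longleftrightarrow> m \<in> k (j (f n))" for f n m
    by (simp add: G_def)
  have "inj G"
  proof (rule injI, rule ext)
    fix f f' n assume "G f = G f'"
    then have "k (j (f n)) = k (j (f' n))"
      using G by blast
    then show "f n = f' n"
      using j kh(1) by (simp add: inj_eq)
  qed
  then have "inj (h \<circ> G)"
    using kh(2) by (simp add: inj_compose)
  then show ?thesis
    using card_of_ordLeq[of "UNIV :: (nat \<Rightarrow> 'k) set" "UNIV :: real set"] by auto
qed

lemma card_complex_le_continuum: "|UNIV :: complex set| \<le>o continuum"
proof -
  have "inj (\<lambda>z n. if n = (0::nat) then Re z else Im z)"
  proof (rule injI)
    fix z w assume eq: "(\<lambda>n. if n = (0::nat) then Re z else Im z) = (\<lambda>n. if n = 0 then Re w else Im w)"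
    show "z = w"
      using fun_cong[OF eq, of 0] fun_cong[OF eq, of 1] by (simp add: complex_eq_iff)
  qed
  then have "|UNIV :: complex set| \<le>o |UNIV :: (nat \<Rightarrow> real) set|"
    using card_of_ordLeq[of "UNIV :: complex set" "UNIV :: (nat \<Rightarrow> real) set"] by blast
  then show ?thesis
    using card_sequences_le_continuum[OF card_of_refl[THEN ordIso_imp_ordLeq]] ordLeq_transitive by blast
qed

section \<open>Closed subspaces and independence modulo a subspace\<close>

locale banach_space_over_complete_field = banach_space_over smul
  for smul :: "'k::{real_normed_field,banach} \<Rightarrow> 'a::banach \<Rightarrow> 'a"
begin

lemma bounded_bilinear_smul: "bounded_bilinear smul"
proof
  fix a a' :: 'k and b b' :: 'a and r :: real
  show "smul (r *\<^sub>R a) b = r *\<^sub>R smul a b"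
    by (simp add: scaleR_conv_of_real smul_of_real flip: scale_scale)
  show "smul a (r *\<^sub>R b) = r *\<^sub>R smul a b"
    by (simp add: mult.commute flip: smul_of_real)
  show "\<exists>K. \<forall>a b. norm (smul a b) \<le> norm a * norm b * K"
    by (rule exI[of _ 1]) (simp add: norm_smul)
qed (simp_all add: scale_left_distrib scale_right_distrib)

lemmas tendsto_smul = bounded_bilinear.tendsto[OF bounded_bilinear_smul]
lemmas bounded_linear_smul_right = bounded_bilinear.bounded_linear_right[OF bounded_bilinear_smul]
lemmas bounded_linear_smul_left = bounded_bilinear.bounded_linear_left[OF bounded_bilinear_smul]

lemma
  assumes "subspace M" "closed M" "x \<notin> M" "m \<in> M"
  shows infdist_subspace_pos: "0 < infdist x M"
    and infdist_subspace_smul_le: "norm c * infdist x M \<le> norm (smul c x + m)"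
proof -
  have "M \<noteq> {}"
    using assms(4) by blast
  then show "0 < infdist x M"
    using assms(2,3) infdist_pos_not_in_closed by blast
  show "norm c * infdist x M \<le> norm (smul c x + m)"
  proof (cases "c = 0")
    case False
    have "- smul (inverse c) m \<in> M"
      using assms(1,4) by (intro subspace_neg subspace_scale)
    then have "infdist x M \<le> dist x (- smul (inverse c) m)"
      by (rule infdist_le)
    also have "\<dots> = norm (smul (inverse c) (smul c x + m))"
      using False by (simp add: dist_norm scale_right_distrib)
    also have "\<dots> = norm (smul c x + m) / norm c"
      by (simp only: norm_smul norm_inverse divide_inverse mult.commute)
    finally show ?thesis
      using False by (simp add: field_simps)
  qed simp
qed

text \<open>
  Modulo \<open>span M\<close>, the coefficient of \<open>x\<close> is controlled by the norm, with factor the distance of \<open>x\<close>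
  from \<open>span M\<close>. So the coefficients along a convergent sequence converge, by completeness of the
  scalar field.
\<close>

lemma closed_span_insert:
  assumes "closed (span M)"
  shows "closed (span (insert x M))"
proof (cases "x \<in> span M")
  case True
  then show ?thesis
    using assms by (simp add: span_redundant)
next
  case False
  define d where "d = infdist x (span M)"
  have d: "0 < d"
    unfolding d_def by (rule infdist_subspace_pos[OF subspace_span assms False span_zero])
  show ?thesis
    unfolding closed_sequential_limits
  proof (intro allI impI)
    fix y l assume "(\<forall>n. y n \<in> span (insert x M)) \<and> y \<longlonglongrightarrow> l"
    then have y: "\<And>n. y n \<in> span (insert x M)" and l: "y \<longlonglongrightarrow> l"
      by auto
    have "\<forall>n. \<exists>k. y n - smul k x \<in> span M"
      using y by (simp add: span_breakdown_eq)
    then obtain a where a: "\<And>n. y n - smul (a n) x \<in> span M"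
      by metis
    have bound: "norm (a m - a n) * d \<le> norm (y m - y n)" for m n
    proof -
      have "(y m - smul (a m) x) - (y n - smul (a n) x) \<in> span M"
        by (rule span_diff[OF a a])
      from infdist_subspace_smul_le[OF subspace_span assms False this, of "a m - a n"]
      show ?thesis
        by (simp add: d_def algebra_simps)
    qed
    have "Cauchy a"
    proof (rule CauchyI)
      fix e :: real assume "0 < e"
      then obtain N where N: "\<And>m n. m \<ge> N \<Longrightarrow> n \<ge> N \<Longrightarrow> norm (y m - y n) < e * d"
        using CauchyD[OF LIMSEQ_imp_Cauchy[OF l], of "e * d"] d by auto
      have "norm (a m - a n) < e" if "m \<ge> N" "n \<ge> N" for m n
        using le_less_trans[OF bound N[OF that]] d by simp
      then show "\<exists>N. \<forall>m\<ge>N. \<forall>n\<ge>N. norm (a m - a n) < e"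
        by blast
    qed
    then obtain c where c: "a \<longlonglongrightarrow> c"
      using Cauchy_convergent convergent_def by blast
    have "(\<lambda>n. y n - smul (a n) x) \<longlonglongrightarrow> l - smul c x"
      by (intro tendsto_diff l tendsto_smul c tendsto_const)
    then have "l - smul c x \<in> span M"
      by (rule closed_sequentially[OF assms a])
    then show "l \<in> span (insert x M)"
      using span_breakdown_eq by blast
  qed
qed

lemma closed_span_Un_finite:
  assumes "finite F" "closed (span M)"
  shows "closed (span (M \<union> F))"
  using assms by (induction F) (auto intro: closed_span_insert)

lemma span_image_explicit:
  assumes "x \<in> span (s ` L)"
  obtains t u where "finite t" "t \<subseteq> L" "x = (\<Sum>l\<in>t. smul (u l) (s l))"
proof -
  obtain S u where S: "finite S" "S \<subseteq> s ` L" "x = (\<Sum>v\<in>S. smul (u v) v)"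
    using assms unfolding span_explicit by auto
  then obtain t where t: "t \<subseteq> L" "inj_on s t" "S = s ` t"
    by (auto simp: subset_image_inj)
  then have "finite t"
    using S(1) t finite_imageD[of s t] by simp
  then show ?thesis
    using that[of t "u \<circ> s"] t S(3) by (simp add: sum.reindex)
qed

lemma independent_image:
  assumes key: "\<And>t u l. finite t \<Longrightarrow> t \<subseteq> L \<Longrightarrow> (\<Sum>l\<in>t. smul (u l) (s l)) = 0 \<Longrightarrow> l \<in> t \<Longrightarrow> u l = 0"
  shows "inj_on s L" "independent (s ` L)"
proof -
  show "inj_on s L"
  proof (rule inj_onI, rule ccontr)
    fix x y assume xy: "x \<in> L" "y \<in> L" "s x = s y" "x \<noteq> y"
    have "(if x = x then 1 else - 1 :: 'k) = 0"
      by (rule key[of "{x, y}" "\<lambda>l. if l = x then 1 else - 1"]) (use xy in auto)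
    then show False by simp
  qed
  show "independent (s ` L)"
    unfolding independent_explicit_finite_subsets
  proof (intro allI impI ballI)
    fix S u v assume S: "S \<subseteq> s ` L" "finite S" "(\<Sum>v\<in>S. smul (u v) v) = 0" "v \<in> S"
    then obtain t where t: "t \<subseteq> L" "inj_on s t" "S = s ` t"
      by (auto simp: subset_image_inj)
    then have "(\<Sum>l\<in>t. smul ((u \<circ> s) l) (s l)) = 0"
      using S(3) by (simp add: sum.reindex)
    moreover have "finite t"
      using t S(2) finite_imageD[of s t] by simp
    ultimately show "u v = 0"
      using key[of t "u \<circ> s"] t S(4) by auto
  qed
qed

text \<open>
  In the quotient by \<open>W\<close> the family \<open>s\<close> is the family \<open>L\<close> with its members multiplied by the nonzero
  scalars \<open>c l\<close>, so it is still independent there.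
\<close>

lemma independent_modulo_subspace:
  assumes W: "subspace W" and L: "independent L" "span L \<inter> W \<subseteq> {0}"
    and s: "\<And>l. l \<in> L \<Longrightarrow> c l \<noteq> 0 \<and> s l - smul (c l) l \<in> W"
  shows "inj_on s L" "independent (s ` L)" "span (s ` L) \<inter> W \<subseteq> {0}"
proof -
  have key: "u l = 0" if t: "finite t" "t \<subseteq> L" and u: "(\<Sum>l\<in>t. smul (u l) (s l)) \<in> W" and "l \<in> t" for t u l
  proof -
    have "(\<Sum>l\<in>t. smul (u l) (s l)) - (\<Sum>l\<in>t. smul (u l) (s l - smul (c l) l)) \<in> W"
      using t s by (intro subspace_diff[OF W u] subspace_sum[OF W] subspace_scale[OF W]) blast
    also have "(\<Sum>l\<in>t. smul (u l) (s l)) - (\<Sum>l\<in>t. smul (u l) (s l - smul (c l) l))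
        = (\<Sum>l\<in>t. smul (u l * c l) l)"
      by (simp add: scale_right_diff_distrib flip: sum_subtractf)
    finally have "(\<Sum>l\<in>t. smul (u l * c l) l) \<in> W" .
    moreover have "(\<Sum>l\<in>t. smul (u l * c l) l) \<in> span L"
      using t by (intro span_sum span_scale) (blast intro: span_base)
    ultimately have "(\<Sum>l\<in>t. smul (u l * c l) l) = 0"
      using L(2) by auto
    from independentD[OF L(1) t this \<open>l \<in> t\<close>] show ?thesis
      using s t \<open>l \<in> t\<close> by auto
  qed
  show "inj_on s L" "independent (s ` L)"
    using independent_image[of L s] key subspace_0[OF W] by auto
  show "span (s ` L) \<inter> W \<subseteq> {0}"
  proof
    fix x assume x: "x \<in> span (s ` L) \<inter> W"
    then obtain t u where t: "finite t" "t \<subseteq> L" "x = (\<Sum>l\<in>t. smul (u l) (s l))"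
      using span_image_explicit by (metis IntD1)
    then have "u l = 0" if "l \<in> t" for l
      using key[of t u] x that by auto
    then show "x \<in> {0}"
      using t by simp
  qed
qed

text \<open>
  The quotient by \<open>W\<close> is infinite-dimensional. If \<open>W\<close> and \<open>F\<close> spanned everything, every \<open>l \<in> L\<close> could
  be moved into \<open>span F\<close> by an element of \<open>W\<close>, which would give infinitely many independent vectors
  in the span of a finite set.
\<close>

lemma not_in_span_Un_finite:
  assumes W: "subspace W" and L: "independent L" "span L \<inter> W \<subseteq> {0}" "infinite L" and F: "finite F"
  shows "span (W \<union> F) \<noteq> UNIV"
proof
  assume *: "span (W \<union> F) = UNIV"
  have "\<exists>y. y \<in> span F \<and> y - smul 1 l \<in> W" for l
  proof -
    have "l \<in> span (W \<union> F)" using * by simp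
    then obtain w y where "l = w + y" "w \<in> span W" "y \<in> span F"
      unfolding span_Un by blast
    then show ?thesis
      using W subspace_neg by (intro exI[of _ y]) (auto simp: span_eq_iff[THEN iffD2])
  qed
  then obtain s where s: "\<And>l. s l \<in> span F" "\<And>l. s l - smul 1 l \<in> W"
    by metis
  have "inj_on s L" "independent (s ` L)"
    using independent_modulo_subspace[OF W L(1,2), of "\<lambda>_. 1" s] s by auto
  moreover have "finite (s ` L)"
    using independent_span_bound[OF F \<open>independent (s ` L)\<close>] s by blast
  ultimately show False
    using L(3) finite_imageD by blast
qed

lemma normalised_sequence_off_subspace:
  assumes codim: "\<And>F. finite F \<Longrightarrow> span (M \<union> F) \<noteq> UNIV"
  obtains x :: "nat \<Rightarrow> 'a" where "\<And>n. norm (x n) = 1" "\<And>n. x n \<notin> span (M \<union> x ` {..<n})"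
proof -
  have "\<exists>y. norm y = 1 \<and> y \<notin> span (M \<union> F)" if F: "finite F" for F
  proof -
    obtain v where v: "v \<notin> span (M \<union> F)"
      using codim[OF F] by blast
    define y where "y = smul (of_real (inverse (norm v))) v"
    have "v \<noteq> 0"
      using v span_zero by blast
    then have "v = smul (of_real (norm v)) y" "norm y = 1"
      unfolding y_def norm_smul scale_scale by (auto simp flip: of_real_mult simp del: of_real_inverse)
    then show ?thesis
      using v span_scale by metis
  qed
  then obtain pick where pick: "\<And>F. finite F \<Longrightarrow> norm (pick F) = 1 \<and> pick F \<notin> span (M \<union> F)"
    by metis
  define X where "X = rec_nat {} (\<lambda>_ F. insert (pick F) F)"
  have X: "X 0 = {}" "X (Suc n) = insert (pick (X n)) (X n)" for n
    by (simp_all add: X_def)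
  have "finite (X n) \<and> X n = (\<lambda>n. pick (X n)) ` {..<n}" for n
    by (induction n) (auto simp: X lessThan_Suc)
  then show ?thesis
    using that[of "\<lambda>n. pick (X n)"] pick by metis
qed

text \<open>
  Take unit vectors \<open>x n\<close>, each at distance \<open>d n > 0\<close> from the span of \<open>M\<close> and its predecessors, and let
  \<open>u n = t n \<cdot> x n\<close> where \<open>t\<close> decreases so fast that the sum of \<open>t m\<close> over \<open>m > n\<close> is at most
  \<open>t n * d n / 7\<close>. Suppose that \<open>\<Sum>n. a n \<cdot> u n\<close> is in \<open>span M\<close>, and let \<open>A\<close> be the supremum of the
  \<open>norm (a n)\<close>. If \<open>A > 0\<close>, some \<open>a j\<close> has norm above \<open>A / 2\<close>. Modulo \<open>M\<close> and the
  predecessors of \<open>x j\<close>, the term of index \<open>j\<close> has size at least \<open>A * t j * d j / 2\<close>, and the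
  terms after it sum to at most \<open>A * t j * d j / 7\<close>, so they cannot cancel it. It is the boundedness
  of \<open>a\<close> that allows a choice of \<open>j\<close> whose coefficient dominates all later ones up to a factor \<open>2\<close>.
\<close>

lemma rapidly_decreasing_sequence_independent:
  assumes M: "closed (span M)" and codim: "\<And>F. finite F \<Longrightarrow> span (M \<union> F) \<noteq> UNIV" and "\<tau> > 0"
  obtains u where "\<And>n. norm (u n) \<le> \<tau> * (1/2) ^ n"
    "\<And>a. bounded (range a) \<Longrightarrow> (\<Sum>n. smul (a n) (u n)) \<in> span M \<Longrightarrow> a = (\<lambda>_. 0)"
proof -
  obtain x :: "nat \<Rightarrow> 'a" where x: "\<And>n. norm (x n) = 1" "\<And>n. x n \<notin> span (M \<union> x ` {..<n})"
    using normalised_sequence_off_subspace[OF codim] by blast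
  define M' where "M' n = span (M \<union> x ` {..<n})" for n
  define d where "d n = infdist (x n) (M' n)" for n
  have cl: "closed (M' n)" for n
    unfolding M'_def by (intro closed_span_Un_finite M) auto
  have d: "0 < d n" "d n \<le> 1" for n
  proof -
    have M': "subspace (M' n)" "0 \<in> M' n" "x n \<notin> M' n"
      using x(2) by (simp_all add: M'_def span_zero)
    show "0 < d n"
      unfolding d_def by (rule infdist_subspace_pos[OF M'(1) cl M'(3,2)])
    show "d n \<le> 1"
      unfolding d_def using infdist_le[OF M'(2), of "x n"] x(1) by simp
  qed
  define t where "t = rec_nat \<tau> (\<lambda>n s. s * d n / 8)"
  have t: "t 0 = \<tau>" "t (Suc n) = t n * d n / 8" for n
    by (simp_all add: t_def)
  have t_pos: "t n > 0" for n
    by (induction n) (simp_all add: t d(1) \<open>\<tau> > 0\<close>)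
  have t_decr: "t (Suc n) \<le> t n / 8" for n
    using d[of n] t_pos[of n] by (simp add: t mult_left_le)
  have t_tail: "t (Suc j + k) \<le> t j * d j * (1/8) ^ Suc k" for j k
  proof (induction k)
    case (Suc k)
    then show ?case using t_decr[of "Suc j + k"] by simp
  qed (simp add: t)
  have t_le: "t n \<le> \<tau> * (1/2) ^ n" for n
  proof (induction n)
    case (Suc n)
    then show ?case using t_decr[of n] t_pos[of n] by simp
  qed (simp add: t)
  define u where "u n = smul (of_real (t n)) (x n)" for n
  have u: "norm (u n) = t n" for n
    using t_pos[of n] by (simp add: u_def norm_smul x)
  show thesis
  proof (rule that)
    show "norm (u n) \<le> \<tau> * (1/2) ^ n" for n
      using u t_le by simp
    fix a :: "nat \<Rightarrow> 'k"
    assume a: "bounded (range a)" and sum: "(\<Sum>n. smul (a n) (u n)) \<in> span M"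
    show "a = (\<lambda>_. 0)"
    proof (rule ccontr)
      assume "a \<noteq> (\<lambda>_. 0)"
      then obtain i where i: "a i \<noteq> 0" by blast
      define A where "A = (SUP n. norm (a n))"
      have bdd: "bdd_above (range (\<lambda>n. norm (a n)))"
        using a by (auto simp: bounded_iff bdd_above_def)
      then have A: "norm (a n) \<le> A" for n
        unfolding A_def by (rule cSUP_upper[OF UNIV_I])
      have "A > 0"
        using A[of i] i by (smt (verit) norm_le_zero_iff)
      then obtain j where j: "A / 2 < norm (a j)"
        using less_cSUP_iff[OF UNIV_not_empty bdd, of "A / 2"] unfolding A_def by auto
      have summable: "summable (\<lambda>n. smul (a n) (u n))"
      proof (rule summable_comparison_test')
        show "summable (\<lambda>n. A * (\<tau> * (1/2) ^ n))"
          by (intro summable_mult summable_geometric) simp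
        show "norm (smul (a n) (u n)) \<le> A * (\<tau> * (1/2) ^ n)" for n
          unfolding norm_smul u using A[of n] t_le[of n] t_pos[of n] \<open>A > 0\<close> by (intro mult_mono) auto
      qed
      define tail where "tail = (\<Sum>k. smul (a (k + Suc j)) (u (k + Suc j)))"
      define m where "m = (\<Sum>n<j. smul (a n) (u n)) - (\<Sum>n. smul (a n) (u n))"
      have "(\<Sum>n. smul (a n) (u n)) \<in> M' j"
        using sum span_mono[of M "M \<union> x ` {..<j}"] by (auto simp: M'_def)
      then have "m \<in> M' j"
        unfolding m_def u_def M'_def by (intro span_diff span_sum span_scale) (auto intro: span_base)
      then have "norm (a j * of_real (t j)) * d j \<le> norm (smul (a j * of_real (t j)) (x j) + m)"
        unfolding d_def M'_def using infdist_subspace_smul_le[OF subspace_span cl[unfolded M'_def]] x by blast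
      also have "smul (a j * of_real (t j)) (x j) + m = - tail"
        using suminf_split_initial_segment[OF summable, of "Suc j"]
        by (simp add: m_def tail_def u_def)
      also have "norm (- tail) \<le> A * (t j * d j) / 7"
      proof -
        have s: "(\<lambda>k. A * (t j * d j / 8) * (1/8) ^ k) sums (A * (t j * d j) / 7)"
          using sums_mult[OF geometric_sums[of "1/8 :: real"], of "A * (t j * d j / 8)"] by simp
        have "norm (smul (a (k + Suc j)) (u (k + Suc j))) \<le> A * (t j * d j / 8) * (1/8) ^ k" for k
        proof -
          have "norm (a (k + Suc j)) * t (k + Suc j) \<le> A * (t j * d j * (1/8) ^ Suc k)"
            using A t_tail[of j k] t_pos[of "k + Suc j"] \<open>A > 0\<close>
            by (intro mult_mono) (auto simp: add.commute)
          then show ?thesis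
            by (simp add: norm_smul u)
        qed
        then have "norm tail \<le> (\<Sum>k. A * (t j * d j / 8) * (1/8) ^ k)"
          unfolding tail_def by (intro norm_suminf_le sums_summable[OF s])
        then show ?thesis
          using sums_unique[OF s] by simp
      qed
      finally have "norm (a j) * (t j * d j) \<le> A / 7 * (t j * d j)"
        using t_pos[of j] by (simp add: norm_mult)
      then have "norm (a j) \<le> A / 7"
        using mult_pos_pos[OF t_pos d(1), of j j] by (rule mult_right_le_imp_le)
      then show False
        using j \<open>A > 0\<close> by simp
    qed
  qed
qed

lemma subspace_closure: assumes "subspace S" shows "subspace (closure S)"
proof (rule subspaceI)
  show "0 \<in> closure S"
    using subspace_0[OF assms] closure_subset by blast
next
  fix x y assume "x \<in> closure S" "y \<in> closure S"
  then obtain f g where "\<And>n. f n \<in> S" "f \<longlonglongrightarrow> x" "\<And>n. g n \<in> S" "g \<longlonglongrightarrow> y"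
    unfolding closure_sequential by metis
  then show "x + y \<in> closure S"
    unfolding closure_sequential using subspace_add[OF assms] tendsto_add[of f x _ g y]
    by (intro exI[of _ "\<lambda>n. f n + g n"]) auto
next
  fix c x assume "x \<in> closure S"
  then obtain f where "\<And>n. f n \<in> S" "f \<longlonglongrightarrow> x"
    unfolding closure_sequential by metis
  then show "smul c x \<in> closure S"
    unfolding closure_sequential using subspace_scale[OF assms] tendsto_smul[OF tendsto_const, of f x _ c]
    by (intro exI[of _ "\<lambda>n. smul c (f n)"]) auto
qed

section \<open>Infinite cardinals\<close>

text \<open>
  Translating infinitely many basis vectors of an \<open>\<alpha>\<close>-dimensional subspace, shrunk towards \<open>0\<close>, by one
  nonzero \<open>w \<in> W\<close> puts \<open>w\<close> into the closure of the span.
\<close>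

lemma not_spaceable_infinite:
  fixes W :: "'a set" and \<alpha> :: "'c rel" and \<beta> :: "'d rel"
  assumes W: "subspace W" "w \<in> W" "w \<noteq> 0" and \<alpha>: "natLeq \<le>o \<alpha>"
  shows "\<not> spaceable smul \<alpha> \<beta> (UNIV - W)"
proof
  assume sp: "spaceable smul \<alpha> \<beta> (UNIV - W)"
  then obtain B where B: "independent B" "|B| =o \<alpha>" "span B \<subseteq> (UNIV - W) \<union> {0}"
    unfolding spaceable_def lineable_def subspace_of_dim_def by metis
  have "natLeq \<le>o |B|"
    using \<alpha> B(2) ordIso_symmetric ordLeq_ordIso_trans by blast
  then have "infinite B"
    using infinite_iff_natLeq_ordLeq by blast
  then obtain b :: "nat \<Rightarrow> 'a" where b: "inj b" "range b \<subseteq> B"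
    using infinite_countable_subset by blast
  \<comment> \<open>Any \<open>\<epsilon> n > 0\<close> with \<open>\<epsilon> n * norm (b n)\<close> tending to \<open>0\<close> would do.\<close>
  define \<epsilon> :: "nat \<Rightarrow> real" where "\<epsilon> n = inverse (real (Suc n)) / (norm (b n) + 1)" for n
  have \<epsilon>: "\<epsilon> n > 0" "norm (smul (of_real (\<epsilon> n)) (b n)) \<le> inverse (real (Suc n))" for n
  proof -
    have p: "0 < norm (b n) + 1" by (simp add: add_nonneg_pos)
    then show "\<epsilon> n > 0" by (simp add: \<epsilon>_def)
    have "norm (smul (of_real (\<epsilon> n)) (b n)) = inverse (real (Suc n)) * (norm (b n) / (norm (b n) + 1))"
      using p by (simp only: norm_smul norm_of_real) (simp add: \<epsilon>_def)
    also have "\<dots> \<le> inverse (real (Suc n)) * 1"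
      using p by (intro mult_left_mono) auto
    finally show "norm (smul (of_real (\<epsilon> n)) (b n)) \<le> inverse (real (Suc n))" by simp
  qed
  \<comment> \<open>The new basis \<open>s ` B\<close> has \<open>w + \<epsilon> n \<cdot> b n\<close> in place of \<open>b n\<close>; \<open>c\<close> holds the scaling factors.\<close>
  define c :: "'a \<Rightarrow> 'k" where "c l = (if l \<in> range b then of_real (\<epsilon> (the_inv b l)) else 1)" for l
  define s where "s l = smul (c l) l + (if l \<in> range b then w else 0)" for l
  have "c l \<noteq> 0 \<and> s l - smul (c l) l \<in> W" for l
    using W subspace_0[OF W(1)] \<epsilon>(1) by (auto simp: c_def s_def less_imp_neq[symmetric])
  moreover have "span B \<inter> W \<subseteq> {0}"
    using B(3) by auto
  ultimately have s: "inj_on s B" "independent (s ` B)" "span (s ` B) \<inter> W \<subseteq> {0}"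
    using independent_modulo_subspace[OF W(1) B(1), of c s] by auto
  have "|s ` B| =o \<alpha>"
    using card_of_ordIsoI[OF inj_on_imp_bij_betw[OF s(1)]] B(2)
    by (meson ordIso_symmetric ordIso_transitive)
  then have "subspace_of_dim smul \<alpha> (span (s ` B))"
    unfolding subspace_of_dim_def using s by auto
  moreover have "span (s ` B) \<subseteq> (UNIV - W) \<union> {0}"
    using s(3) by auto
  ultimately obtain T where T: "closed T" "span (s ` B) \<subseteq> T" "T \<subseteq> (UNIV - W) \<union> {0}"
    using sp unfolding spaceable_def by metis
  have "s (b n) \<in> T" for n
    using b(2) T(2) by (auto intro: span_base)
  moreover have "(\<lambda>n. s (b n)) \<longlonglongrightarrow> w"
  proof -
    have "(\<lambda>n. smul (of_real (\<epsilon> n)) (b n)) \<longlonglongrightarrow> 0"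
      by (rule Lim_null_comparison[OF _ LIMSEQ_inverse_real_of_nat]) (use \<epsilon>(2) in auto)
    then have "(\<lambda>n. smul (of_real (\<epsilon> n)) (b n) + w) \<longlonglongrightarrow> 0 + w"
      by (intro tendsto_add tendsto_const)
    then show ?thesis
      using b(1) by (simp add: s_def c_def the_inv_f_f)
  qed
  ultimately have "w \<in> T"
    using T(1) closed_sequentially by metis
  then show False
    using T(3) W by auto
qed

end

section \<open>Boundedness of the coefficients of a regular basic sequence\<close>

locale regular_basic_sequence_in = banach_space_over_complete_field smul
  for smul :: "'k::{real_normed_field,banach} \<Rightarrow> 'a::banach \<Rightarrow> 'a" +
  fixes e :: "nat \<Rightarrow> 'a"
  assumes regular: "regular_basic_sequence smul e"
begin

definition E :: "'a set" where "E = closure (span (range e))"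

definition coef :: "'a \<Rightarrow> nat \<Rightarrow> 'k" where
  "coef y = (THE a. (\<lambda>n. smul (a n) (e n)) sums y)"

definition partial :: "nat \<Rightarrow> 'a \<Rightarrow> 'a" where
  "partial N y = (\<Sum>n<N. smul (coef y n) (e n))"

lemma subspace_E: "subspace E"
  unfolding E_def by (intro subspace_closure subspace_span)

lemma closed_E: "closed E"
  by (simp add: E_def)

lemma sums_in_E: "(\<lambda>n. smul (a n) (e n)) sums y \<Longrightarrow> y \<in> E"
  unfolding E_def closure_sequential sums_def
  by (intro exI[of _ "\<lambda>N. \<Sum>n<N. smul (a n) (e n)"] conjI allI span_sum span_scale) (auto intro: span_base)

lemma coef_ex1: "y \<in> E \<Longrightarrow> \<exists>!a. (\<lambda>n. smul (a n) (e n)) sums y"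
  using regular unfolding regular_basic_sequence_def basic_sequence_def schauder_basis_def E_def by blast

lemma coef_sums: "y \<in> E \<Longrightarrow> (\<lambda>n. smul (coef y n) (e n)) sums y"
  unfolding coef_def by (rule theI'[OF coef_ex1])

lemma coef_eqI: "(\<lambda>n. smul (a n) (e n)) sums y \<Longrightarrow> coef y = a"
  using coef_ex1 coef_sums sums_in_E by blast

lemma coef_add: "x \<in> E \<Longrightarrow> y \<in> E \<Longrightarrow> coef (x + y) = (\<lambda>n. coef x n + coef y n)"
  by (rule coef_eqI) (simp add: scale_left_distrib sums_add coef_sums)

lemma coef_smul: "x \<in> E \<Longrightarrow> coef (smul c x) = (\<lambda>n. c * coef x n)"
  using bounded_linear.sums[OF bounded_linear_smul_right coef_sums, of x c]
  by (intro coef_eqI) simp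

lemma coef_diff: "x \<in> E \<Longrightarrow> y \<in> E \<Longrightarrow> coef (x - y) = (\<lambda>n. coef x n - coef y n)"
  by (rule coef_eqI) (simp add: scale_left_diff_distrib sums_diff coef_sums)

lemma partial_tendsto: "y \<in> E \<Longrightarrow> (\<lambda>N. partial N y) \<longlonglongrightarrow> y"
  using coef_sums[of y] unfolding sums_def partial_def .

lemma partial_diff: "x \<in> E \<Longrightarrow> y \<in> E \<Longrightarrow> partial N (x - y) = partial N x - partial N y"
  by (simp add: partial_def coef_diff scale_left_diff_distrib sum_subtractf)

lemma partial_smul: "x \<in> E \<Longrightarrow> partial N (smul c x) = smul c (partial N x)"
  by (simp add: partial_def coef_smul scale_sum_right)

lemma norm_e_lower: obtains \<delta> where "\<delta> > 0" "\<And>n. \<delta> \<le> norm (e n)"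
proof -
  obtain U where U: "open U" "0 \<in> U" "range e \<inter> U = {}"
    using regular unfolding regular_basic_sequence_def by blast
  then obtain d where "d > 0" "ball 0 d \<subseteq> U"
    unfolding open_contains_ball by blast
  then show ?thesis
    using U(3) by (intro that[of d]) (force simp: not_less[symmetric])+
qed

text \<open>
  The first half of the open mapping argument. The sets \<open>A k\<close> of vectors whose partial sums are bounded
  by \<open>k\<close> cover the complete space \<open>E\<close>, so by Baire's theorem the closure of one of them contains a
  relative ball around some \<open>x0\<close>. Differences of elements of \<open>A k\<close> near \<open>x0 + t y\<close> and near \<open>x0\<close>
  then approximate \<open>t y\<close>, for every \<open>y\<close> in a ball around \<open>0\<close>, with partial sums bounded by \<open>2 k\<close>.
\<close>

lemma partial_sums_approximation:
  obtains K where "K > 0"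
    "\<And>y \<delta>. y \<in> E \<Longrightarrow> \<delta> > 0 \<Longrightarrow> \<exists>z\<in>E. norm (y - z) < \<delta> \<and> (\<forall>N. norm (partial N z) \<le> K * norm y)"
proof -
  define A where "A k = {y \<in> E. \<forall>N. norm (partial N y) \<le> real k}" for k
  have AE: "closure (A k) \<subseteq> E" for k
    by (rule closure_minimal) (auto simp: A_def closed_E)
  have "y \<in> (\<Union>k. A k)" if "y \<in> E" for y
  proof -
    have "Bseq (\<lambda>N. partial N y)"
      using partial_tendsto[OF that] convergent_def convergent_imp_Bseq by blast
    then obtain B where B: "\<And>N. norm (partial N y) \<le> B"
      unfolding Bseq_def by blast
    obtain k where "B \<le> real k"
      using real_arch_simple by blast
    then show ?thesis
      using B that by (auto simp: A_def intro!: exI[of _ k] intro: order_trans)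
  qed
  then have "E \<subseteq> (\<Union>k. A k)"
    by (rule subsetI)
  also have "\<dots> \<subseteq> (\<Union>k. closure (A k))"
    by (intro UN_mono closure_subset order_refl)
  finally have U: "(\<Union>k. closure (A k)) = E"
    using AE by (intro equalityI UN_least)
  have "\<exists>k. top_of_set E interior_of closure (A k) \<noteq> {}"
  proof (rule ccontr)
    assume neg: "\<nexists>k. top_of_set E interior_of closure (A k) \<noteq> {}"
    have "top_of_set E interior_of \<Union> (range (\<lambda>k. closure (A k))) = {}"
    proof (rule Baire_category_alt)
      show "completely_metrizable_space (top_of_set E) \<or>
          locally_compact_space (top_of_set E) \<and> regular_space (top_of_set E)"
        using completely_metrizable_space_closedin completely_metrizable_space_euclidean closed_E
          closed_closedin by blast
    qed (use neg AE in \<open>auto intro!: closed_subset\<close>)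
    then show False
      using subspace_0[OF subspace_E] by (simp add: U interior_of_topspace[of "top_of_set E", simplified])
  qed
  then obtain k x0 where "x0 \<in> top_of_set E interior_of closure (A k)"
    by blast
  then obtain r where r: "r > 0" "\<And>y. y \<in> E \<Longrightarrow> dist y x0 < r \<Longrightarrow> y \<in> closure (A k)" and x0: "x0 \<in> E"
    unfolding interior_of_def openin_euclidean_subtopology_iff by (smt (verit) mem_Collect_eq subset_iff)
  define K where "K = 4 * real k / r + 1"
  show thesis
  proof (rule that)
    show "K > 0"
      using r(1) by (simp add: K_def add_nonneg_pos)
    fix y \<delta> assume y: "y \<in> E" and \<delta>: "(\<delta>::real) > 0"
    show "\<exists>z\<in>E. norm (y - z) < \<delta> \<and> (\<forall>N. norm (partial N z) \<le> K * norm y)"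
    proof (cases "y = 0")
      case True
      have "partial N 0 = 0" for N
        using partial_diff[OF y y, of N] by simp
      then show ?thesis
        using True y \<delta> by (intro bexI[of _ 0]) auto
    next
      case False
      define t where "t = r / (2 * norm y)"
      have t: "t > 0"
        using False r(1) by (simp add: t_def)
      have near: "\<exists>u\<in>A k. dist u x < t * \<delta> / 2" if "x \<in> E" "dist x x0 < r" for x
        using closure_approachableD[OF r(2)[OF that], of "t * \<delta> / 2"] t \<delta> by (auto simp: dist_commute)
      have "smul (of_real t) y \<in> E"
        using y by (intro subspace_scale[OF subspace_E])
      then have "x0 + t *\<^sub>R y \<in> E"
        using x0 subspace_add[OF subspace_E] by (simp add: smul_of_real)
      moreover have "dist (x0 + t *\<^sub>R y) x0 < r"
        using False r(1) by (simp add: dist_norm t_def)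
      ultimately obtain u where u: "u \<in> A k" "dist u (x0 + t *\<^sub>R y) < t * \<delta> / 2"
        using near by blast
      obtain v where v: "v \<in> A k" "dist v x0 < t * \<delta> / 2"
        using near[OF x0] r(1) by auto
      have uv: "u \<in> E" "v \<in> E" "u - v \<in> E"
        using u v by (auto simp: A_def intro: subspace_diff[OF subspace_E])
      define z where "z = smul (of_real (1 / t)) (u - v)"
      have z: "z = (1 / t) *\<^sub>R (u - v)"
        unfolding z_def by (rule smul_of_real)
      have "z \<in> E"
        unfolding z_def using uv by (intro subspace_scale[OF subspace_E])
      moreover have "norm (y - z) < \<delta>"
      proof -
        have "y - z = (1 / t) *\<^sub>R ((v - x0) - (u - (x0 + t *\<^sub>R y)))"
          using t by (simp add: z algebra_simps)
        then have "norm (y - z) = (1 / t) * norm ((v - x0) - (u - (x0 + t *\<^sub>R y)))"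
          using t by simp
        also have "norm ((v - x0) - (u - (x0 + t *\<^sub>R y))) < t * \<delta>"
          using norm_triangle_ineq4[of "v - x0" "u - (x0 + t *\<^sub>R y)"] u(2) v(2) by (simp add: dist_norm)
        finally show ?thesis
          using t by (simp add: field_simps)
      qed
      moreover have "norm (partial N z) \<le> K * norm y" for N
      proof -
        have "norm (partial N z) = (1 / t) * norm (partial N u - partial N v)"
          using t unfolding z_def partial_smul[OF uv(3)] partial_diff[OF uv(1,2)] norm_smul
          by (simp only: norm_of_real) simp
        also have "\<dots> \<le> (1 / t) * (real k + real k)"
          using u v t by (intro mult_left_mono norm_triangle_le_diff add_mono) (auto simp: A_def)
        also have "\<dots> = 4 * real k / r * norm y"
          by (simp add: t_def)
        also have "\<dots> \<le> K * norm y"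
          by (simp add: K_def algebra_simps)
        finally show ?thesis .
      qed
      ultimately show ?thesis by blast
    qed
  qed
qed

text \<open>
  The second half: iterating \<open>partial_sums_approximation\<close> on the errors writes \<open>y = \<Sum>n. z n\<close> with
  the partial sums of \<open>z n\<close> bounded by \<open>K * norm y / 2 ^ n\<close>. Dominated convergence allows
  the interchange of this series with the basis expansions, so the coefficients of \<open>y\<close> are the sums of
  those of the \<open>z n\<close>. The lower bound on \<open>norm (e i)\<close> turns bounds on the terms of an expansion into
  bounds on its coefficients.
\<close>

lemma coef_bound:
  obtains C where "C > 0" "\<And>y n. y \<in> E \<Longrightarrow> norm (coef y n) \<le> C * norm y"
proof -
  obtain \<delta> where \<delta>: "\<delta> > 0" "\<And>n. \<delta> \<le> norm (e n)"
    using norm_e_lower by blast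
  obtain K where K: "K > 0" and
    approx: "\<And>y \<delta>. y \<in> E \<Longrightarrow> \<delta> > 0 \<Longrightarrow> \<exists>z\<in>E. norm (y - z) < \<delta> \<and> (\<forall>N. norm (partial N z) \<le> K * norm y)"
    using partial_sums_approximation by blast
  then obtain ap where ap: "\<And>y \<delta>. y \<in> E \<Longrightarrow> \<delta> > 0 \<Longrightarrow>
      ap y \<delta> \<in> E \<and> norm (y - ap y \<delta>) < \<delta> \<and> (\<forall>N. norm (partial N (ap y \<delta>)) \<le> K * norm y)"
    by metis
  have main: "norm (coef y i) \<le> 4 * K / \<delta> * norm y" if y: "y \<in> E" "y \<noteq> 0" for y i
  proof -
    define d where "d n = norm y * (1/2) ^ n" for n
    have d: "d n > 0" for n using y(2) by (simp add: d_def)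
    \<comment> \<open>\<open>r n\<close> is the error after \<open>n\<close> approximation steps, \<open>z n\<close> the approximation of that error.\<close>
    define r where "r = rec_nat y (\<lambda>n x. x - ap x (d (Suc n)))"
    have r_simps: "r 0 = y" "r (Suc n) = r n - ap (r n) (d (Suc n))" for n
      by (simp_all add: r_def)
    define z where "z n = ap (r n) (d (Suc n))" for n
    have r: "r n \<in> E \<and> norm (r n) \<le> d n" for n
    proof (induction n)
      case (Suc n)
      then show ?case
        using ap[of "r n" "d (Suc n)"] d by (auto simp: r_simps intro: subspace_diff[OF subspace_E] less_imp_le)
    qed (simp add: r_simps d_def y)
    have z: "z n \<in> E" "norm (partial N (z n)) \<le> K * d n" for n N
      using ap[of "r n" "d (Suc n)"] r[of n] d[of "Suc n"] K
      by (auto simp: z_def intro: order_trans mult_left_mono)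
    have zn: "norm (z n) \<le> 2 * d n" for n
    proof -
      have "norm (z n) = norm (r n - r (Suc n))"
        by (simp add: r_simps z_def)
      also have "\<dots> \<le> d n + d (Suc n)"
        using r by (intro norm_triangle_le_diff add_mono) auto
      also have "\<dots> \<le> 2 * d n"
        using d[of n] by (simp add: d_def)
      finally show ?thesis .
    qed
    have d_sums: "d sums (2 * norm y)"
      using sums_mult[OF geometric_sums[of "1/2 :: real"], of "norm y"]
      by (simp add: d_def[abs_def] mult.commute)
    have sum_z: "(\<Sum>n<m. z n) = y - r m" for m
      by (induction m) (simp_all add: r_simps z_def)
    have "r \<longlonglongrightarrow> 0"
      by (rule Lim_null_comparison[OF _ summable_LIMSEQ_zero[OF sums_summable[OF d_sums]]]) (use r in auto)
    then have z_sums: "z sums y"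
      using tendsto_diff[OF tendsto_const[of y] , of r 0] by (simp add: sums_def sum_z)
    have cz: "norm (coef (z n) i) \<le> 2 * K / \<delta> * d n" for n i
    proof -
      have "norm (coef (z n) i) * \<delta> \<le> norm (coef (z n) i) * norm (e i)"
        using \<delta> by (intro mult_left_mono) auto
      also have "\<dots> = norm (partial (Suc i) (z n) - partial i (z n))"
        by (simp add: partial_def norm_smul)
      also have "\<dots> \<le> K * d n + K * d n"
        by (intro norm_triangle_le_diff add_mono z)
      finally show ?thesis
        using \<delta>(1) by (simp add: field_simps)
    qed
    define b where "b i = (\<Sum>n. coef (z n) i)" for i
    have cz_sum: "summable (\<lambda>n. norm (coef (z n) i))" for i
      by (rule summable_comparison_test'[OF summable_mult[OF sums_summable[OF d_sums], of "2 * K / \<delta>"]])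
        (use cz in auto)
    have b_bound: "norm (b i) \<le> 4 * K / \<delta> * norm y" for i
    proof -
      have "norm (b i) \<le> (\<Sum>n. norm (coef (z n) i))"
        unfolding b_def by (rule summable_norm[OF cz_sum])
      also have "\<dots> \<le> (\<Sum>n. 2 * K / \<delta> * d n)"
        using cz by (intro suminf_le cz_sum summable_mult sums_summable[OF d_sums])
      also have "\<dots> = 2 * K / \<delta> * (2 * norm y)"
        by (rule sums_unique[symmetric, OF sums_mult[OF d_sums]])
      finally show ?thesis by simp
    qed
    have pz_sums: "(\<lambda>n. partial N (z n)) sums (\<Sum>i<N. smul (b i) (e i))" for N
      unfolding partial_def b_def
      by (intro sums_sum bounded_linear.sums[OF bounded_linear_smul_left] summable_sums
          summable_norm_cancel[OF cz_sum])
    have dom: "norm (z n - partial N (z n)) \<le> (2 + K) * d n" for n N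
      using norm_triangle_ineq4[of "z n" "partial N (z n)"] zn[of n] z(2)[of N n] by (simp add: algebra_simps)
    have Msum: "summable (\<lambda>n. (2 + K) * d n)"
      by (intro summable_mult sums_summable[OF d_sums])
    have "(\<lambda>N. norm (z n - partial N (z n))) \<longlonglongrightarrow> 0" for n
      using tendsto_diff[OF tendsto_const partial_tendsto[OF z(1)], of "z n" n]
      by (intro tendsto_norm_zero) simp
    moreover have "\<forall>\<^sub>F (n, N) in at_top \<times>\<^sub>F sequentially.
        norm (norm (z n - partial N (z n))) \<le> (2 + K) * d n"
      using dom by (intro always_eventually) auto
    ultimately have lim: "(\<lambda>N. \<Sum>n. norm (z n - partial N (z n))) \<longlonglongrightarrow> 0"
      using tannerys_theorem[of "\<lambda>n N. norm (z n - partial N (z n))" "\<lambda>_. 0" sequentially "\<lambda>n. (2 + K) * d n"] Msum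
      by simp
    have "norm (y - (\<Sum>i<N. smul (b i) (e i))) \<le> (\<Sum>n. norm (z n - partial N (z n)))" for N
    proof -
      have "y - (\<Sum>i<N. smul (b i) (e i)) = (\<Sum>n. z n - partial N (z n))"
        by (rule sums_unique[OF sums_diff[OF z_sums pz_sums]])
      moreover have "summable (\<lambda>n. norm (z n - partial N (z n)))"
        by (rule summable_comparison_test'[OF Msum]) (use dom in auto)
      ultimately show ?thesis
        using summable_norm by metis
    qed
    then have "(\<lambda>N. y - (\<Sum>i<N. smul (b i) (e i))) \<longlonglongrightarrow> 0"
      by (intro Lim_null_comparison[OF _ lim]) auto
    then have "(\<lambda>i. smul (b i) (e i)) sums y"
      unfolding sums_def using tendsto_diff[OF tendsto_const[of y]] by fastforce
    then show ?thesis
      using b_bound coef_eqI by metis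
  qed
  show thesis
  proof (rule that[of "4 * K / \<delta>"])
    show "4 * K / \<delta> > 0" using K \<delta> by simp
    have "coef 0 = (\<lambda>_. 0)"
      by (rule coef_eqI) simp
    then show "norm (coef y i) \<le> 4 * K / \<delta> * norm y" if "y \<in> E" for y i
      using main[OF that] by (cases "y = 0") auto
  qed
qed

section \<open>Closed extensions of continuum dimension\<close>

lemma coef_tendsto_0: "y \<in> E \<Longrightarrow> coef y \<longlonglongrightarrow> 0"
proof -
  assume y: "y \<in> E"
  obtain \<delta> where \<delta>: "\<delta> > 0" "\<And>n. \<delta> \<le> norm (e n)"
    using norm_e_lower by blast
  have "(\<lambda>n. norm (smul (coef y n) (e n))) \<longlonglongrightarrow> 0"
    by (intro tendsto_norm_zero summable_LIMSEQ_zero sums_summable[OF coef_sums[OF y]])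
  then have "(\<lambda>n. norm (smul (coef y n) (e n)) / \<delta>) \<longlonglongrightarrow> 0"
    using tendsto_divide_zero by blast
  moreover have "norm (coef y n) \<le> norm (smul (coef y n) (e n)) / \<delta>" for n
    using \<delta> by (simp add: norm_smul field_simps mult_right_mono)
  ultimately show ?thesis
    using Lim_null_comparison by (metis (mono_tags, lifting) always_eventually)
qed

text \<open>
  The vector \<open>v r\<close> has the coefficients \<open>r ^ n / norm (e n)\<close>; since coefficients are unique,
  a linear relation among the \<open>v r\<close> is one among geometric sequences with distinct ratios.
\<close>

lemma geometric_family_independent:
  assumes "\<And>n. e n \<noteq> 0"
  obtains v :: "real \<Rightarrow> 'a" where "\<And>r. r \<in> {0<..<1} \<Longrightarrow> v r \<in> E"
    "\<And>t c l. finite t \<Longrightarrow> t \<subseteq> {0<..<1} \<Longrightarrow> (\<Sum>r\<in>t. smul (c r) (v r)) = 0 \<Longrightarrow> l \<in> t \<Longrightarrow> c l = 0"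
proof -
  define a where "a r n = (of_real (r ^ n / norm (e n)) :: 'k)" for r n
  define v where "v r = (\<Sum>n. smul (a r n) (e n))" for r
  have sums: "(\<lambda>n. smul (a r n) (e n)) sums v r" if r: "r \<in> {0<..<1}" for r
    unfolding v_def
  proof (rule summable_sums, rule summable_comparison_test')
    show "summable (\<lambda>n. r ^ n)"
      using r by (intro summable_geometric) auto
    show "norm (smul (a r n) (e n)) \<le> r ^ n" for n
      using r assms[of n] unfolding norm_smul a_def norm_of_real by simp
  qed
  have indep: "c l = 0" if t: "finite t" "t \<subseteq> {0<..<1}" "(\<Sum>r\<in>t. smul (c r) (v r)) = 0" "l \<in> t" for t c l
  proof (rule Vandermonde_eq_0[OF t(1) _ _ t(4)])
    show "inj_on (of_real :: real \<Rightarrow> 'k) t"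
      by (simp add: inj_on_def)
    fix n
    have "(\<lambda>n. \<Sum>r\<in>t. smul (c r) (smul (a r n) (e n))) sums (\<Sum>r\<in>t. smul (c r) (v r))"
      using t(2) sums by (intro sums_sum bounded_linear.sums[OF bounded_linear_smul_right]) auto
    then have "(\<lambda>n. smul (\<Sum>r\<in>t. c r * a r n) (e n)) sums 0"
      by (simp add: t(3) scale_sum_left)
    then have "(\<lambda>n. \<Sum>r\<in>t. c r * a r n) = coef 0"
      using coef_eqI by metis
    also have "coef 0 = (\<lambda>_. 0)"
      by (rule coef_eqI) simp
    finally have "(\<Sum>r\<in>t. c r * a r n) = 0"
      by (rule fun_cong)
    also have "(\<Sum>r\<in>t. c r * a r n) = (\<Sum>r\<in>t. c r * of_real r ^ n) / of_real (norm (e n))"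
      by (simp add: a_def sum_divide_distrib)
    finally show "(\<Sum>r\<in>t. c r * of_real r ^ n) = 0"
      using assms[of n] by simp
  qed
  show thesis
    using that[of v] sums_in_E[OF sums] indep by blast
qed

text \<open>
  The space is \<open>\<Phi> ` E + span F\<close>, where \<open>\<Phi> y = y + (\<Sum>n. coef y n \<cdot> u n)\<close> and \<open>u\<close> comes from
  \<open>rapidly_decreasing_sequence_independent\<close> for \<open>W \<union> F\<close>.
\<close>

lemma closed_continuum_dimensional_extension:
  assumes K: "|UNIV :: 'k set| \<le>o continuum"
    and W: "subspace W" "closed W" "range e \<subseteq> W"
    and codim: "\<And>F. finite F \<Longrightarrow> span (W \<union> F) \<noteq> UNIV"
    and F: "finite F" "span F \<inter> W \<subseteq> {0}"
  obtains T where "closed T" "subspace_of_dim smul continuum T" "span F \<subseteq> T" "T \<inter> W \<subseteq> {0}"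
proof -
  have spanW: "span W = W"
    using W(1) by (simp add: span_eq_iff)
  have EW: "E \<subseteq> W"
    unfolding E_def using W by (intro closure_minimal span_minimal) auto
  obtain C where C: "C > 0" "\<And>y n. y \<in> E \<Longrightarrow> norm (coef y n) \<le> C * norm y"
    using coef_bound by blast
  have "closed (span (W \<union> F))"
    using W(2) F(1) by (intro closed_span_Un_finite) (auto simp: spanW)
  moreover have "span ((W \<union> F) \<union> F') \<noteq> UNIV" if "finite F'" for F'
    using codim[of "F \<union> F'"] F(1) that by (simp add: Un_assoc)
  ultimately obtain u where u: "\<And>n. norm (u n) \<le> 1 / (4 * C) * (1/2) ^ n"
    "\<And>a. bounded (range a) \<Longrightarrow> (\<Sum>n. smul (a n) (u n)) \<in> span (W \<union> F) \<Longrightarrow> a = (\<lambda>_. 0)"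
    using rapidly_decreasing_sequence_independent[of "W \<union> F" "1 / (4 * C)"] C(1) by auto
  \<comment> \<open>The size of \<open>u\<close> is chosen such that \<open>norm (g y) \<le> norm y / 2\<close>, which makes \<open>\<Phi>\<close> bounded below.\<close>
  define g where "g y = (\<Sum>n. smul (coef y n) (u n))" for y
  have term_le: "norm (smul (coef y n) (u n)) \<le> norm y / 4 * (1/2) ^ n" if "y \<in> E" for y n
  proof -
    have "norm (coef y n) * norm (u n) \<le> (C * norm y) * (1 / (4 * C) * (1/2) ^ n)"
      using C(1) C(2)[OF that] u(1) by (intro mult_mono) auto
    then show ?thesis
      using C(1) by (simp add: norm_smul)
  qed
  have geo: "(\<lambda>n. norm y / 4 * (1/2) ^ n) sums (norm y / 2)" for y :: 'a
    using sums_mult[OF geometric_sums[of "1/2 :: real"], of "norm y / 4"] by simp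
  have g_sums: "(\<lambda>n. smul (coef y n) (u n)) sums g y" if "y \<in> E" for y
    unfolding g_def
    by (intro summable_sums summable_comparison_test'[OF sums_summable[OF geo]]) (rule term_le[OF that])
  have g_bound: "norm (g y) \<le> norm y / 2" if "y \<in> E" for y
    unfolding g_def sums_unique[OF geo[of y]]
    by (rule norm_suminf_le[OF term_le[OF that] sums_summable[OF geo]])
  have g_add: "g (x + y) = g x + g y" if "x \<in> E" "y \<in> E" for x y
    using sums_add[OF g_sums[OF that(1)] g_sums[OF that(2)]] that
      sums_unique2[OF g_sums[OF subspace_add[OF subspace_E that]]]
    by (simp add: coef_add scale_left_distrib)
  have g_smul: "g (smul c y) = smul c (g y)" if "y \<in> E" for c y
    using bounded_linear.sums[OF bounded_linear_smul_right g_sums[OF that], of c] that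
      sums_unique2[OF g_sums[OF subspace_scale[OF subspace_E that]]]
    by (simp add: coef_smul)
  define \<Phi> where "\<Phi> y = y + g y" for y
  have \<Phi>_add: "\<Phi> (x + y) = \<Phi> x + \<Phi> y" if "x \<in> E" "y \<in> E" for x y
    using g_add[OF that] by (simp add: \<Phi>_def)
  have \<Phi>_smul: "\<Phi> (smul c y) = smul c (\<Phi> y)" if "y \<in> E" for c y
    using g_smul[OF that] by (simp add: \<Phi>_def scale_right_distrib)
  have \<Phi>_0: "\<Phi> 0 = 0"
    using \<Phi>_smul[OF subspace_0[OF subspace_E], of 0] by simp
  have \<Phi>_diff: "\<Phi> (x - y) = \<Phi> x - \<Phi> y" if "x \<in> E" "y \<in> E" for x y
    using \<Phi>_add[OF subspace_diff[OF subspace_E that] that(2)] by simp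
  have \<Phi>_sum: "\<Phi> (\<Sum>r\<in>t. smul (c r) (v r)) = (\<Sum>r\<in>t. smul (c r) (\<Phi> (v r)))"
    if "finite t" "\<And>r. r \<in> t \<Longrightarrow> v r \<in> E" for t :: "real set" and c v
    using that
  proof (induction t)
    case (insert r t)
    then have "smul (c r) (v r) \<in> E" "(\<Sum>r\<in>t. smul (c r) (v r)) \<in> E"
      by (auto intro!: subspace_sum[OF subspace_E] subspace_scale[OF subspace_E])
    then show ?case
      using insert by (simp add: \<Phi>_add \<Phi>_smul)
  qed (simp add: \<Phi>_0)
  have \<Phi>_lower: "norm y \<le> 2 * norm (\<Phi> y)" if "y \<in> E" for y
    using norm_diff_ineq[of y "g y"] g_bound[OF that] by (simp add: \<Phi>_def)
  have \<Phi>_upper: "norm (\<Phi> y) \<le> 2 * norm y" if "y \<in> E" for y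
    using norm_triangle_ineq[of y "g y"] g_bound[OF that] norm_ge_zero[of y] unfolding \<Phi>_def by linarith
  have sub: "subspace (\<Phi> ` E)"
  proof (rule subspaceI)
    show "0 \<in> \<Phi> ` E"
      using \<Phi>_0 subspace_0[OF subspace_E] by force
    show "x + y \<in> \<Phi> ` E" if "x \<in> \<Phi> ` E" "y \<in> \<Phi> ` E" for x y
      using that \<Phi>_add subspace_add[OF subspace_E] by (metis (no_types, lifting) image_iff)
    show "smul c x \<in> \<Phi> ` E" if "x \<in> \<Phi> ` E" for c x
      using that \<Phi>_smul subspace_scale[OF subspace_E] by (metis (no_types, lifting) image_iff)
  qed
  have "closed (\<Phi> ` E)"
    unfolding closed_sequential_limits
  proof (intro allI impI)
    fix z l assume "(\<forall>n. z n \<in> \<Phi> ` E) \<and> z \<longlonglongrightarrow> l"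
    then have "\<forall>n. \<exists>y. y \<in> E \<and> z n = \<Phi> y" and l: "z \<longlonglongrightarrow> l"
      by auto
    then obtain y where y: "\<And>n. y n \<in> E" "\<And>n. z n = \<Phi> (y n)"
      by metis
    have "Cauchy y"
    proof (rule CauchyI)
      fix \<epsilon> :: real assume "0 < \<epsilon>"
      then obtain N where N: "\<And>m n. m \<ge> N \<Longrightarrow> n \<ge> N \<Longrightarrow> norm (z m - z n) < \<epsilon> / 2"
        using CauchyD[OF LIMSEQ_imp_Cauchy[OF l], of "\<epsilon> / 2"] by auto
      have "norm (y m - y n) < \<epsilon>" if "m \<ge> N" "n \<ge> N" for m n
        using \<Phi>_lower[OF subspace_diff[OF subspace_E y(1) y(1)], of m n] N[OF that]
        by (simp add: \<Phi>_diff y)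
      then show "\<exists>N. \<forall>m\<ge>N. \<forall>n\<ge>N. norm (y m - y n) < \<epsilon>"
        by blast
    qed
    then obtain y' where y': "y \<longlonglongrightarrow> y'"
      using Cauchy_convergent convergent_def by blast
    then have y'E: "y' \<in> E"
      using closed_E y(1) closed_sequentially by blast
    have "(\<lambda>n. z n - \<Phi> y') \<longlonglongrightarrow> 0"
    proof (rule Lim_null_comparison)
      show "\<forall>\<^sub>F n in sequentially. norm (z n - \<Phi> y') \<le> 2 * norm (y n - y')"
        using \<Phi>_upper[OF subspace_diff[OF subspace_E y(1) y'E]] y'E y by (simp add: \<Phi>_diff)
      show "(\<lambda>n. 2 * norm (y n - y')) \<longlonglongrightarrow> 0"
        using y' by (auto intro!: tendsto_mult_right_zero tendsto_norm_zero simp: LIM_zero_iff)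
    qed
    then have "z \<longlonglongrightarrow> \<Phi> y'"
      by (simp add: LIM_zero_iff)
    then have "l = \<Phi> y'"
      using l LIMSEQ_unique by blast
    then show "l \<in> \<Phi> ` E"
      using y'E by blast
  qed
  then have closed: "closed (span (\<Phi> ` E \<union> F))"
    using F(1) sub by (intro closed_span_Un_finite) (auto simp: span_eq_iff[THEN iffD2])
  define T where "T = span (\<Phi> ` E \<union> F)"
  have T: "\<exists>y\<in>E. \<exists>s\<in>span F. x = \<Phi> y + s" if "x \<in> T" for x
    using that sub unfolding T_def span_Un by (auto simp: span_eq_iff[THEN iffD2])
  have TW: "T \<inter> W \<subseteq> {0}"
  proof
    fix x assume x: "x \<in> T \<inter> W"
    then obtain y s where y: "y \<in> E" and s: "s \<in> span F" and xys: "x = \<Phi> y + s"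
      using T by blast
    \<comment> \<open>The difference is \<open>g y\<close>, and \<open>y \<in> E \<subseteq> W\<close>.\<close>
    have "x - y - s \<in> span (W \<union> F)"
    proof (intro span_diff)
      show "x \<in> span (W \<union> F)" "y \<in> span (W \<union> F)"
        using x y EW by (auto intro: span_base)
      show "s \<in> span (W \<union> F)"
        using s span_mono[of F "W \<union> F"] by auto
    qed
    then have "g y \<in> span (W \<union> F)"
      by (simp add: xys \<Phi>_def)
    moreover have "bounded (range (coef y))"
      using coef_tendsto_0[OF y] convergent_imp_bounded by blast
    ultimately have "coef y = (\<lambda>_. 0)"
      using u(2) unfolding g_def by blast
    then have "y = 0"
      using coef_sums[OF y] sums_unique2[OF sums_zero] by force
    then have "x = s"
      using xys \<Phi>_0 by simp
    then show "x \<in> {0}"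
      using x s F(2) by auto
  qed
  have card_le: "|T| \<le>o continuum"
  proof -
    obtain h where h: "bij_betw h {..<card F} F"
      using ex_bij_betw_nat_finite[OF F(1)] by (auto simp: atLeast0LessThan)
    define p where "p = card F"
    \<comment> \<open>Every element of \<open>T\<close> is coded by one scalar sequence: the first \<open>p\<close> entries are coordinates in \<open>span F\<close>, the others are the coefficients of the preimage in \<open>E\<close>.\<close>
    define G where "G a = \<Phi> (\<Sum>n. smul (a (n + p)) (e n)) + (\<Sum>i<p. smul (a i) (h i))" for a :: "nat \<Rightarrow> 'k"
    have "x \<in> range G" if "x \<in> T" for x
    proof -
      obtain y s where y: "y \<in> E" and s: "s \<in> span F" and xys: "x = \<Phi> y + s"
        using T[OF \<open>x \<in> T\<close>] by blast
      obtain c where "s = (\<Sum>v\<in>F. smul (c v) v)"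
        using s span_finite[OF F(1)] by auto
      then have c: "s = (\<Sum>i<p. smul (c (h i)) (h i))"
        using sum.reindex_bij_betw[OF h, of "\<lambda>v. smul (c v) v"] by (simp add: p_def)
      define a where "a n = (if n < p then c (h n) else coef y (n - p))" for n
      have "G a = x"
        using sums_unique[OF coef_sums[OF y]] by (simp add: G_def a_def xys c)
      then show ?thesis by blast
    qed
    then have "|T| \<le>o |UNIV :: (nat \<Rightarrow> 'k) set|"
      by (intro surj_imp_ordLeq[of T G]) auto
    then show ?thesis
      using card_sequences_le_continuum[OF K] ordLeq_transitive by blast
  qed
  obtain \<delta> where "\<delta> > 0" "\<And>n. \<delta> \<le> norm (e n)"
    using norm_e_lower by blast
  then have e0: "e n \<noteq> 0" for n
    by (metis norm_zero not_le)
  obtain v :: "real \<Rightarrow> 'a" where v: "\<And>r. r \<in> {0<..<1} \<Longrightarrow> v r \<in> E"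
    "\<And>t c l. finite t \<Longrightarrow> t \<subseteq> {0<..<1} \<Longrightarrow> (\<Sum>r\<in>t. smul (c r) (v r)) = 0 \<Longrightarrow> l \<in> t \<Longrightarrow> c l = 0"
    using geometric_family_independent[OF e0] by blast
  have key: "c l = 0"
    if t: "finite t" "t \<subseteq> {0<..<1}" "(\<Sum>r\<in>t. smul (c r) (\<Phi> (v r))) = 0" "l \<in> t" for t c l
  proof (rule v(2)[OF t(1,2) _ t(4)])
    have "\<Phi> (\<Sum>r\<in>t. smul (c r) (v r)) = 0"
      using \<Phi>_sum[OF t(1), of v c] t(2,3) v(1) by (simp add: subset_iff)
    moreover have "(\<Sum>r\<in>t. smul (c r) (v r)) \<in> E"
      using t v(1) by (intro subspace_sum[OF subspace_E] subspace_scale[OF subspace_E]) auto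
    ultimately show "(\<Sum>r\<in>t. smul (c r) (v r)) = 0"
      using \<Phi>_lower by fastforce
  qed
  let ?B0 = "(\<lambda>r. \<Phi> (v r)) ` {0<..<1}"
  have B0: "inj_on (\<lambda>r. \<Phi> (v r)) {0<..<1}" "independent ?B0"
    using independent_image[of "{0<..<1}" "\<lambda>r. \<Phi> (v r)"] key by blast+
  have "?B0 \<subseteq> T"
    using v(1) by (auto simp: T_def intro!: span_base)
  then obtain B where B: "?B0 \<subseteq> B" "B \<subseteq> T" "independent B" "T \<subseteq> span B"
    using maximal_independent_subset_extend[OF _ B0(2)] by blast
  have "span B = T"
    using B(2,4) span_minimal[of B T] by (auto simp: T_def)
  have "(UNIV :: real set) \<lesssim> {0<..<1::real}"
    using open_interval_eqpoll_reals[of 0 1] eqpoll_imp_lepoll eqpoll_sym by auto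
  then have "continuum \<le>o |{0<..<1::real}|"
    unfolding lepoll_def by (simp only: card_of_ordLeq)
  also have "|{0<..<1::real}| \<le>o |B|"
    using B0(1) B(1) card_of_ordLeq by blast
  finally have "continuum \<le>o |B|" .
  moreover have "|B| \<le>o continuum"
    using card_of_mono1[OF B(2)] card_le ordLeq_transitive by blast
  ultimately have "|B| =o continuum"
    by (simp add: ordIso_iff_ordLeq)
  then have "subspace_of_dim smul continuum T"
    unfolding subspace_of_dim_def using B(3) \<open>span B = T\<close> by (auto simp: T_def)
  moreover have "span F \<subseteq> T"
    unfolding T_def by (intro span_mono) auto
  ultimately show thesis
    using that[of T] closed TW by (simp add: T_def)
qed

end

section \<open>The characterisation\<close>

context banach_space_over_complete_field begin

text \<open>
  The cardinality assumption on the scalar field bounds the dimension of the extensions by the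
  continuum. For finite \<open>\<alpha>\<close>, a countably infinite-dimensional subspace avoiding \<open>W\<close> serves twice: its
  subspaces give lineability, and it shows that the quotient by \<open>W\<close> is infinite-dimensional.
\<close>

lemma spaceable_complement_iff:
  fixes \<alpha> :: "'c rel"
  assumes K: "|UNIV :: 'k set| \<le>o continuum"
    and W: "subspace W" "closed W" "W \<noteq> UNIV" 
    and e: "range e \<subseteq> W" "regular_basic_sequence smul e"
    and lin: "lineable smul natLeq (UNIV - W)"
    and \<alpha>: "Card_order \<alpha>" "\<alpha> \<le>o continuum"
  shows "spaceable smul \<alpha> continuum (UNIV - W) \<longleftrightarrow> \<alpha> <o natLeq"
proof
  interpret regular_basic_sequence_in smul e
    by unfold_locales (rule e)
  assume sp: "spaceable smul \<alpha> continuum (UNIV - W)"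
  show "\<alpha> <o natLeq"
  proof (rule ccontr)
    assume "\<not> \<alpha> <o natLeq"
    then have "natLeq \<le>o \<alpha>"
      using ordLess_or_ordLeq[OF card_order_on_well_order_on[OF \<alpha>(1)] natLeq_Well_order] by blast
    moreover have "e 0 \<in> W" "e 0 \<noteq> 0"
      using e(1) norm_e_lower by (blast, metis norm_zero not_le)
    ultimately show False
      using not_spaceable_infinite[OF W(1)] sp by blast
  qed
next
  interpret regular_basic_sequence_in smul e
    by unfold_locales (rule e)
  assume "\<alpha> <o natLeq"
  obtain L where L: "independent L" "span L \<subseteq> (UNIV - W) \<union> {0}" "|L| =o natLeq"
    using lin unfolding lineable_def subspace_of_dim_def by metis
  have "infinite L"
    using L(3) infinite_iff_natLeq_ordLeq ordIso_iff_ordLeq by blast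
  then have codim: "span (W \<union> F) \<noteq> UNIV" if "finite F" for F
    using not_in_span_Un_finite[OF W(1) L(1)] L(2) that by blast
  show "spaceable smul \<alpha> continuum (UNIV - W)"
    unfolding spaceable_def
  proof (intro conjI allI impI)
    show "\<alpha> \<le>o continuum" "UNIV - W \<noteq> {}"
      using \<alpha> W by auto
    show "lineable smul \<alpha> (UNIV - W)"
    proof -
      have "|Field \<alpha>| \<le>o |L|"
        using card_of_Field_ordIso[OF \<alpha>(1)] \<open>\<alpha> <o natLeq\<close> L(3)
        by (meson ordIso_ordLeq_trans ordIso_symmetric ordLeq_ordIso_trans ordLess_imp_ordLeq)
      then obtain L' where L': "L' \<subseteq> L" "|Field \<alpha>| =o |L'|"
        using internalize_card_of_ordLeq2[of "Field \<alpha>" L] by blast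
      then have "|L'| =o \<alpha>"
        using card_of_Field_ordIso[OF \<alpha>(1)] by (meson ordIso_symmetric ordIso_transitive)
      then have "subspace_of_dim smul \<alpha> (span L')"
        unfolding subspace_of_dim_def using independent_mono[OF L(1) L'(1)] by auto
      then show ?thesis
        unfolding lineable_def using L(2) span_mono[OF L'(1)] by blast
    qed
    fix S assume S: "subspace_of_dim smul \<alpha> S \<and> S \<subseteq> UNIV - W \<union> {0}"
    then obtain F where F: "span F = S" "|F| =o \<alpha>"
      unfolding subspace_of_dim_def by blast
    then have "finite F"
      using \<open>\<alpha> <o natLeq\<close> finite_iff_ordLess_natLeq ordIso_ordLess_trans by blast
    have FW: "span F \<inter> W \<subseteq> {0}"
      using S F(1) by auto
    obtain T where "closed T" "subspace_of_dim smul continuum T" "span F \<subseteq> T" "T \<inter> W \<subseteq> {0}"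
      by (rule closed_continuum_dimensional_extension[OF K W(1,2) e(1) _ \<open>finite F\<close> FW]) (rule codim)
    then show "\<exists>T. closed T \<and> subspace_of_dim smul continuum T \<and> S \<subseteq> T \<and> T \<subseteq> UNIV - W \<union> {0}"
      using F(1) by blast
  qed
qed

end

theorem corollary3p7:
  shows
    "(\<forall>W :: 'a::banach set.
        subspace W \<and> closed W \<and> W \<noteq> UNIV \<and>
        (\<exists>e. range e \<subseteq> W \<and> regular_basic_sequence ((*\<^sub>R) :: real \<Rightarrow> 'a \<Rightarrow> 'a) e) \<and>
        lineable ((*\<^sub>R) :: real \<Rightarrow> 'a \<Rightarrow> 'a) natLeq (UNIV - W) \<longrightarrow>
        (\<forall>\<alpha> :: 'c rel. Card_order \<alpha> \<and> \<alpha> \<le>o continuum \<longrightarrow>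
           (spaceable ((*\<^sub>R) :: real \<Rightarrow> 'a \<Rightarrow> 'a) \<alpha> continuum (UNIV - W) \<longleftrightarrow> \<alpha> <o natLeq)))
     \<and>
     (\<forall>(smul :: complex \<Rightarrow> 'b::banach \<Rightarrow> 'b) W.
        banach_space_over smul \<and>
        module.subspace smul W \<and> closed W \<and> W \<noteq> UNIV \<and>
        (\<exists>e. range e \<subseteq> W \<and> regular_basic_sequence smul e) \<and>
        lineable smul natLeq (UNIV - W) \<longrightarrow>
        (\<forall>\<alpha> :: 'c rel. Card_order \<alpha> \<and> \<alpha> \<le>o continuum \<longrightarrow>
           (spaceable smul \<alpha> continuum (UNIV - W) \<longleftrightarrow> \<alpha> <o natLeq)))"
proof (intro conjI allI impI)
  interpret banach_space_over_complete_field "(*\<^sub>R) :: real \<Rightarrow> 'a \<Rightarrow> 'a"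
    by unfold_locales (auto simp: algebra_simps)
  fix W :: "'a set" and \<alpha> :: "'c rel"
  assume W: "subspace W \<and> closed W \<and> W \<noteq> UNIV \<and>
        (\<exists>e. range e \<subseteq> W \<and> regular_basic_sequence ((*\<^sub>R) :: real \<Rightarrow> 'a \<Rightarrow> 'a) e) \<and>
        lineable ((*\<^sub>R) :: real \<Rightarrow> 'a \<Rightarrow> 'a) natLeq (UNIV - W)"
    and \<alpha>: "Card_order \<alpha> \<and> \<alpha> \<le>o continuum"
  have "module.subspace ((*\<^sub>R) :: real \<Rightarrow> 'a \<Rightarrow> 'a) W"
    using W by (simp add: subspace_raw_def)
  then show "spaceable ((*\<^sub>R) :: real \<Rightarrow> 'a \<Rightarrow> 'a) \<alpha> continuum (UNIV - W) \<longleftrightarrow> \<alpha> <o natLeq"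
    using spaceable_complement_iff[OF card_of_refl[THEN ordIso_imp_ordLeq], of W _ \<alpha>] W \<alpha> by blast
next
  fix smul :: "complex \<Rightarrow> 'b \<Rightarrow> 'b" and W :: "'b set" and \<alpha> :: "'c rel"
  assume W: "banach_space_over smul \<and>
        module.subspace smul W \<and> closed W \<and> W \<noteq> UNIV \<and>
        (\<exists>e. range e \<subseteq> W \<and> regular_basic_sequence smul e) \<and>
        lineable smul natLeq (UNIV - W)"
    and \<alpha>: "Card_order \<alpha> \<and> \<alpha> \<le>o continuum"
  then interpret banach_space_over_complete_field smul
    by (simp add: banach_space_over_complete_field_def)
  show "spaceable smul \<alpha> continuum (UNIV - W) \<longleftrightarrow> \<alpha> <o natLeq"
    using spaceable_complement_iff[OF card_complex_le_continuum, of W _ \<alpha>] W \<alpha> by blast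
qed

end
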